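(* Let $\mathbf P=(P,\leq,{}')$ be a poset with an antitone involution. Then the Dedekind-MacNeille completion $\mathbf{DM}(\mathbf P)=(\mathrm{DM}(\mathbf P),\subseteq,{}^* )$ is a pseudo-Kleene algebra if and only if $\mathbf P$ is a pseudo-Kleene poset.
   Context: Let $(P,\leq)$ be a poset. For $A,B\subseteq P$ write $A\leq B$ if $x\leq y$ for all $x\in A$, $y\in B$. Put $L(A)=\{x\in P\mid x\leq y\text{ for all }y\in A\}$ and $U(A)=\{x\in P\mid y\leq x\text{ for all }y\in A\}$; write $L(a,b)=L(\{a,b\})$, $U(a,b)=U(\{a,b\})$. A unary operation $'$ on $P$ is antitone if $x\leq y$ implies $y'\leq x'$, and an involution if $x''=x$ for all $x$. For $A\subseteq P$ put $A'=\{x'\mid x\in A\}$. A pseudo-Kleene poset is a poset $(P,\leq,{}')$ with an antitone involution satisfying $L(x,x')\leq U(y,y')$ for all $x,y\in P$. A pseudo-Kleene algebra is a lattice $(L,\vee,\wedge,{}')$ with an antitone involution satisfying $x\wedge x'\leq y\vee y'$ for all $x,y\in L$. For a poset $\mathbf P=(P,\leq,{}')$ with an antitone involution put $\mathrm{DM}(\mathbf P)=\{L(A)\mid A\subseteq P\}$ and $A^*=L(A')$ for $A\in\mathrm{DM}(\mathbf P)$. The structure $\mathbf{DM}(\mathbf P)=(\mathrm{DM}(\mathbf P),\subseteq,{}^* )$ is a complete lattice with an antitone involution (with $A\wedge B=A\cap B$ and $A\vee B=L(U(A\cup B))$), called the Dedekind-MacNeille completion of $\mathbf P$. *)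

theory Defs
  imports "HOL-Algebra.Lattice"
begin

record 'a involution_order = "'a gorder" +
  neg :: "'a \<Rightarrow> 'a"

locale antitone_involution_poset = partial_order P
  for P :: "('a, 'b) involution_order_scheme" (structure) +
  assumes neg_closed: "x \<in> carrier P \<Longrightarrow> neg P x \<in> carrier P"
    and neg_antitone:
      "\<lbrakk>x \<in> carrier P; y \<in> carrier P; x \<sqsubseteq> y\<rbrakk> \<Longrightarrow> neg P y \<sqsubseteq> neg P x"
    and neg_neg: "x \<in> carrier P \<Longrightarrow> neg P (neg P x) = x"

definition set_le :: "('a, 'b) gorder_scheme \<Rightarrow> 'a set \<Rightarrow> 'a set \<Rightarrow> bool"
  where "set_le P A B \<longleftrightarrow> (\<forall>x\<in>A. \<forall>y\<in>B. x \<sqsubseteq>\<^bsub>P\<^esub> y)"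

locale pseudo_kleene_poset = antitone_involution_poset +
  assumes pseudo_kleene:
    "\<lbrakk>x \<in> carrier P; y \<in> carrier P\<rbrakk>
      \<Longrightarrow> set_le P (Lower P {x, neg P x}) (Upper P {y, neg P y})"

locale pseudo_kleene_algebra = antitone_involution_poset + lattice P +
  assumes pseudo_kleene:
    "\<lbrakk>x \<in> carrier P; y \<in> carrier P\<rbrakk> \<Longrightarrow> x \<sqinter> neg P x \<sqsubseteq> y \<squnion> neg P y"

text \<open>Only the order and the involution are part of the completion; its binary meet and join
  (intersection, respectively \<open>Lower P (Upper P (A \<union> B))\<close>) are determined by the inclusion order.\<close>

definition DM :: "('a, 'b) involution_order_scheme \<Rightarrow> 'a set involution_order"
  where "DM P =
    \<lparr>carrier = {Lower P A | A. A \<subseteq> carrier P},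
     eq = (=),
     le = (\<subseteq>),
     neg = (\<lambda>A. Lower P (neg P ` A))\<rparr>"

end

theory Submission
  imports Defs
begin

text \<open>
  The elements of the completion are the cuts, that is, the sets \<open>A\<close> with \<open>A = L(U(A))\<close>, and
  \<open>A\<^sup>* = L(A')\<close> is the image of \<open>U(A)\<close> under the involution. An element \<open>a \<in> A \<inter> A\<^sup>*\<close>
  lies in \<open>A\<close> and below every element of \<open>A'\<close>, so in particular \<open>a \<le> a'\<close>, that is,
  \<open>a \<in> L(a,a')\<close> (\<open>le_neg_if_mem_cut_and_neg\<close>). Dually, an upper bound \<open>u\<close>
  of \<open>B \<union> B\<^sup>*\<close> satisfies \<open>u' \<in> B\<^sup>*\<close>, hence \<open>u' \<le> u\<close>, that is, \<open>u \<in> U(u,u')\<close>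
  (\<open>neg_le_if_upper_of_cut_and_neg\<close>). If \<open>P\<close> is
  pseudo-Kleene then \<open>a \<le> u\<close> follows from the instance \<open>L(a,a') \<le> U(u,u')\<close>, and thus
  \<open>A \<inter> A\<^sup>* \<subseteq> L(U(B \<union> B\<^sup>*))\<close>, which is the inequality required in the completion.

  Conversely, \<open>P\<close> embeds into its completion as the principal cuts \<open>L(x)\<close>, and the embedding
  respects the involution: \<open>L(x)\<^sup>* = L(x')\<close> (\<open>Lower_neg_principal\<close>).
  The inequality of the completion at \<open>L(x)\<close> and \<open>L(y)\<close>
  says that \<open>L(x,x')\<close> is contained in \<open>L(U(L(y) \<union> L(y')))\<close>, and \<open>U(L(y) \<union> L(y')) = U(y,y')\<close>.
\<close>

lemma DM_simps [simp]:
  "eq (DM P) = (=)"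
  "le (DM P) = (\<subseteq>)"
  "neg (DM P) = (\<lambda>A. Lower P (neg P ` A))"
  by (simp_all add: DM_def)

context antitone_involution_poset
begin

lemma Lower_in_DM: "A \<subseteq> carrier P \<Longrightarrow> Lower P A \<in> carrier (DM P)"
  by (auto simp: DM_def)

text \<open>\<^const>\<open>Lower\<close> and \<^const>\<open>Upper\<close> form a Galois connection, so the values of \<^const>\<open>Lower\<close> are the
  fixed points of the associated closure operator.\<close>

lemma cut_iff:
  "A \<in> carrier (DM P) \<longleftrightarrow> A \<subseteq> carrier P \<and> Lower P (Upper P A) = A"
proof
  assume "A \<in> carrier (DM P)"
  then obtain B where B: "B \<subseteq> carrier P" and A: "A = Lower P B"
    by (auto simp: DM_def)
  have "B \<subseteq> Upper P A" "A \<subseteq> Lower P (Upper P A)"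
    using B unfolding A Lower_def Upper_def by auto
  then show "A \<subseteq> carrier P \<and> Lower P (Upper P A) = A"
    using Lower_antimono[of B "Upper P A" P] A by auto
next
  assume "A \<subseteq> carrier P \<and> Lower P (Upper P A) = A"
  then show "A \<in> carrier (DM P)"
    using Lower_in_DM[OF Upper_closed] by metis
qed

lemma neg_image_closed: "A \<subseteq> carrier P \<Longrightarrow> neg P ` A \<subseteq> carrier P"
  using neg_closed by auto

text \<open>An antitone involution is an order anti-automorphism, so it exchanges upper and lower bounds.\<close>

lemma Lower_neg_image:
  assumes A: "A \<subseteq> carrier P"
  shows "Lower P (neg P ` A) = neg P ` Upper P A"
proof
  show "Lower P (neg P ` A) \<subseteq> neg P ` Upper P A"
  proof
    fix x assume "x \<in> Lower P (neg P ` A)"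
    then have x: "x \<in> carrier P" and le: "\<And>a. a \<in> A \<Longrightarrow> x \<sqsubseteq> neg P a"
      using neg_image_closed[OF A] by (auto simp: Lower_def)
    have "a \<sqsubseteq> neg P x" if "a \<in> A" for a
    proof -
      have "a \<in> carrier P" using A that by blast
      then show ?thesis
        using neg_antitone[OF x neg_closed le[OF that]] neg_neg by simp
    qed
    then have "neg P x \<in> Upper P A" using x neg_closed by (auto intro: Upper_memI)
    then show "x \<in> neg P ` Upper P A" using neg_neg[OF x] by (metis image_eqI)
  qed
  show "neg P ` Upper P A \<subseteq> Lower P (neg P ` A)"
    using A neg_antitone neg_closed by (auto simp: Upper_def Lower_def subset_iff)
qed

text \<open>The double star is the closure operator \<open>A \<mapsto> L(U(A))\<close>, because the two applications of the
  involution cancel.\<close>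

lemma DM_neg_neg:
  assumes A: "A \<subseteq> carrier P"
  shows "Lower P (neg P ` Lower P (neg P ` A)) = Lower P (Upper P A)"
proof -
  have "neg P (neg P x) = x" if "x \<in> Upper P A" for x
    using neg_neg[OF subsetD[OF Upper_closed that]] .
  then have "neg P ` neg P ` Upper P A = Upper P A"
    by (simp add: image_image)
  then show ?thesis by (simp add: Lower_neg_image[OF A])
qed

lemma DM_antitone_involution: "antitone_involution_poset (DM P)"
proof
  fix A assume "A \<in> carrier (DM P)"
  then show "neg (DM P) A \<in> carrier (DM P)"
    by (simp add: cut_iff[of A] Lower_in_DM neg_image_closed)
next
  fix A assume "A \<in> carrier (DM P)"
  then show "neg (DM P) (neg (DM P) A) = A"
    by (simp add: cut_iff DM_neg_neg)
next
  fix A B assume "A \<sqsubseteq>\<^bsub>DM P\<^esub> B"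
  then show "neg (DM P) B \<sqsubseteq>\<^bsub>DM P\<^esub> neg (DM P) A"
    by (simp add: Lower_antimono image_mono)
qed auto

text \<open>Cuts are closed under intersection because \<open>L(C) \<inter> L(D) = L(C \<union> D)\<close>.\<close>

lemma DM_greatest:
  assumes A: "A \<in> carrier (DM P)" and B: "B \<in> carrier (DM P)"
  shows "greatest (DM P) (A \<inter> B) (Lower (DM P) {A, B})"
proof -
  obtain C D where "C \<subseteq> carrier P" "A = Lower P C" "D \<subseteq> carrier P" "B = Lower P D"
    using A B by (auto simp: DM_def)
  then have "A \<inter> B = Lower P (C \<union> D)" "C \<union> D \<subseteq> carrier P"
    by (auto simp: Lower_def)
  then have "A \<inter> B \<in> carrier (DM P)" by (simp add: Lower_in_DM)
  then show ?thesis
    using A B by (intro greatest_LowerI) (auto simp: Lower_def)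
qed

text \<open>The join is the closure of the union: a cut containing \<open>A \<union> B\<close> also contains \<open>L(U(A \<union> B))\<close>.\<close>

lemma DM_least:
  assumes A: "A \<in> carrier (DM P)" and B: "B \<in> carrier (DM P)"
  shows "least (DM P) (Lower P (Upper P (A \<union> B))) (Upper (DM P) {A, B})"
proof (rule least_UpperI)
  have "A \<union> B \<subseteq> carrier P" using A B by (simp add: cut_iff)
  then have "A \<union> B \<subseteq> Lower P (Upper P (A \<union> B))"
    unfolding Lower_def Upper_def by auto
  then show "X \<sqsubseteq>\<^bsub>DM P\<^esub> Lower P (Upper P (A \<union> B))" if "X \<in> {A, B}" for X
    using that by auto
next
  fix X assume "X \<in> Upper (DM P) {A, B}"
  then have "A \<union> B \<subseteq> X" and "X \<in> carrier (DM P)"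
    using A B by (auto simp: Upper_def)
  then have "Lower P (Upper P (A \<union> B)) \<subseteq> X"
    using Lower_antimono[OF Upper_antimono[of "A \<union> B" X P], of P] by (simp add: cut_iff)
  then show "Lower P (Upper P (A \<union> B)) \<sqsubseteq>\<^bsub>DM P\<^esub> X" by simp
qed (use A B in \<open>simp_all add: Lower_in_DM\<close>)

lemma DM_lattice: "lattice (DM P)"
proof -
  interpret DM: antitone_involution_poset "DM P" by (rule DM_antitone_involution)
  show ?thesis
    by unfold_locales (use DM_least DM_greatest in blast)+
qed

lemma DM_meet:
  assumes "A \<in> carrier (DM P)" "B \<in> carrier (DM P)"
  shows "A \<sqinter>\<^bsub>DM P\<^esub> B = A \<inter> B"
proof -
  interpret DM: lattice "DM P" by (rule DM_lattice)
  show ?thesis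
    by (rule DM.meetI) (use assms DM_greatest DM.greatest_unique in blast)+
qed

lemma DM_join:
  assumes "A \<in> carrier (DM P)" "B \<in> carrier (DM P)"
  shows "A \<squnion>\<^bsub>DM P\<^esub> B = Lower P (Upper P (A \<union> B))"
proof -
  interpret DM: lattice "DM P" by (rule DM_lattice)
  show ?thesis
    by (rule DM.joinI) (use assms DM_least DM.least_unique in blast)+
qed

lemma Upper_principal:
  assumes x: "x \<in> carrier P"
  shows "Upper P (Lower P {x}) = Upper P {x}"
  using x le_trans by (auto simp: Upper_def Lower_def)

lemma Lower_neg_principal:
  assumes x: "x \<in> carrier P"
  shows "Lower P (neg P ` Lower P {x}) = Lower P {neg P x}"
  using Lower_neg_image[of "{x}"] Lower_neg_image[of "Lower P {x}"] x
  by (simp add: Upper_principal)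

lemma le_neg_if_mem_cut_and_neg:
  assumes "A \<subseteq> carrier P" "a \<in> A" "a \<in> Lower P (neg P ` A)"
  shows "a \<sqsubseteq> neg P a"
  using assms neg_image_closed[of A] by (auto simp: Lower_def)

text \<open>The order dual of the preceding fact: the negation of an upper bound of \<open>B\<close> lies in \<open>B\<^sup>*\<close>.\<close>

lemma neg_le_if_upper_of_cut_and_neg:
  assumes B: "B \<subseteq> carrier P" and u: "u \<in> Upper P (B \<union> Lower P (neg P ` B))"
  shows "neg P u \<sqsubseteq> u"
proof -
  have "u \<in> Upper P B" using u by (auto simp: Upper_def)
  then have "neg P u \<in> Lower P (neg P ` B)" by (simp add: Lower_neg_image[OF B])
  then show ?thesis using u subsetD[OF Lower_closed[of P "neg P ` B"]] by (simp add: Upper_def)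
qed

lemma DM_pseudo_kleene_if_poset:
  assumes "pseudo_kleene_poset P"
  shows "pseudo_kleene_algebra (DM P)"
proof -
  interpret K: pseudo_kleene_poset P by (rule assms)
  interpret DM: antitone_involution_poset "DM P" by (rule DM_antitone_involution)
  interpret DM: lattice "DM P" by (rule DM_lattice)
  show ?thesis
  proof
    fix A B assume A: "A \<in> carrier (DM P)" and B: "B \<in> carrier (DM P)"
    have Ac: "A \<subseteq> carrier P" and Bc: "B \<subseteq> carrier P" using A B by (simp_all add: cut_iff)
    have "A \<inter> Lower P (neg P ` A) \<subseteq> Lower P (Upper P (B \<union> Lower P (neg P ` B)))"
    proof
      fix a assume a: "a \<in> A \<inter> Lower P (neg P ` A)"
      then have ac: "a \<in> carrier P" using Ac by blast
      show "a \<in> Lower P (Upper P (B \<union> Lower P (neg P ` B)))"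
      proof (rule Lower_memI)
        fix u assume u: "u \<in> Upper P (B \<union> Lower P (neg P ` B))"
        then have uc: "u \<in> carrier P" by (simp add: Upper_def)
        have "a \<in> Lower P {a, neg P a}"
          using le_neg_if_mem_cut_and_neg[OF Ac] a ac by (auto intro: Lower_memI)
        moreover have "u \<in> Upper P {u, neg P u}"
          using neg_le_if_upper_of_cut_and_neg[OF Bc u] uc by (auto intro: Upper_memI)
        ultimately show "a \<sqsubseteq> u"
          using K.pseudo_kleene[OF ac uc] by (simp add: set_le_def)
      qed (rule ac)
    qed
    then show "A \<sqinter>\<^bsub>DM P\<^esub> neg (DM P) A \<sqsubseteq>\<^bsub>DM P\<^esub> B \<squnion>\<^bsub>DM P\<^esub> neg (DM P) B"
      using DM_meet[OF A DM.neg_closed[OF A]] DM_join[OF B DM.neg_closed[OF B]] by simp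
  qed
qed

lemma poset_pseudo_kleene_if_DM:
  assumes "pseudo_kleene_algebra (DM P)"
  shows "pseudo_kleene_poset P"
proof
  interpret K: pseudo_kleene_algebra "DM P" by (rule assms)
  fix x y assume x: "x \<in> carrier P" and y: "y \<in> carrier P"
  have principal: "Lower P {z} \<in> carrier (DM P)" if "z \<in> carrier P" for z
    using that by (simp add: Lower_in_DM)
  have "Lower P {x} \<inter> Lower P {neg P x}
      \<subseteq> Lower P (Upper P (Lower P {y} \<union> Lower P {neg P y}))"
    using K.pseudo_kleene[OF principal[OF x] principal[OF y]] x y
    by (simp add: Lower_neg_principal DM_meet DM_join principal neg_closed)
  moreover have "Lower P {x, neg P x} = Lower P {x} \<inter> Lower P {neg P x}"
    by (auto simp: Lower_def)
  moreover have "Upper P (Lower P {y} \<union> Lower P {neg P y}) = Upper P {y, neg P y}"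
  proof -
    have "Upper P (Lower P {y} \<union> Lower P {neg P y})
        = Upper P (Lower P {y}) \<inter> Upper P (Lower P {neg P y})"
      by (auto simp: Upper_def)
    also have "\<dots> = Upper P {y} \<inter> Upper P {neg P y}"
      using y by (simp add: Upper_principal neg_closed)
    also have "\<dots> = Upper P {y, neg P y}" by (auto simp: Upper_def)
    finally show ?thesis .
  qed
  ultimately have "Lower P {x, neg P x} \<subseteq> Lower P (Upper P {y, neg P y})" by simp
  then show "set_le P (Lower P {x, neg P x}) (Upper P {y, neg P y})"
    unfolding set_le_def using Lower_memD[OF subsetD _ Upper_closed] by metis
qed

end

theorem theorem3p1:
  fixes P :: "('a, 'b) involution_order_scheme"
  assumes "antitone_involution_poset P"
  shows "pseudo_kleene_algebra (DM P) \<longleftrightarrow> pseudo_kleene_poset P"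
  using antitone_involution_poset.DM_pseudo_kleene_if_poset[OF assms]
    antitone_involution_poset.poset_pseudo_kleene_if_DM[OF assms] by blast

end
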